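(* Let $F$ be a distribution function on $[0,\infty)$ with $F(0)=0$, let $\alpha>0$ and $0\le\theta\le\alpha$. Consider the following statements (all limits are as $x\to\infty$): (a) $\overline{F}(x)\in RV_{\theta-\alpha}$; (b) $\overline{G}_\alpha(x)\in RV_{\theta-\alpha}$; (c) $W_\alpha(x)\in RV_\theta$; (d) $\overline{F}(x)/\overline{G}_\alpha(x)\to\theta/\alpha$; (e) $H_\alpha(x)\in RV_\theta$; (f) $x^\alpha\overline{F}(x)/H_\alpha(x)\to\theta/(\alpha-\theta)$; (g) $x^\alpha\overline{G}_\alpha(x)/H_\alpha(x)\to\alpha/(\alpha-\theta)$; (h) $x^\alpha\overline{F}(x)/W_\alpha(x)\to\theta$. Then: (i) If $0<\theta<\alpha$, the statements (a), (b), (c), (d), (e), (f), (g), (h) are all equivalent. (ii) If $\theta=0$, the statements (b), (c), (d), (e), (f), (g), (h) are all equivalent. (iii) If $\theta=\alpha$, the statements (a), (b), (c) are equivalent, and (b) implies (d).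
   Context: For a distribution function $F$ on $[0,\infty)$ with $F(0)=0$, write $\overline{F}(x)=1-F(x)$. For $\alpha>0$ and $x>0$ define $H_\alpha(x)=\int_{[0,x]}y^\alpha\,dF(y)$, $W_\alpha(x)=\int_0^x y^{\alpha-1}\overline{F}(y)\,dy$, and the Williamson transform $G_\alpha(x)=\int_{[0,x]}\left(1-(t/x)^\alpha\right)dF(t)$, with $\overline{G}_\alpha(x)=1-G_\alpha(x)$. For $\rho\in\mathbb{R}$, $RV_\rho$ is the class of regularly varying functions of index $\rho$: $f\in RV_\rho$ if for every $t>0$, $f(tx)/(t^\rho f(x))\to1$ as $x\to\infty$. *)

theory Defs
  imports "HOL-Analysis.Analysis"
begin

text \<open>
  A (proper, right-continuous) distribution function on \<open>[0, \<infinity>)\<close>, extended by \<open>0\<close> to the negative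
  half-line, so that \<^const>\<open>interval_measure\<close> is the associated Lebesgue--Stieltjes measure.
\<close>

definition nonneg_distribution_function :: "(real \<Rightarrow> real) \<Rightarrow> bool" where
  "nonneg_distribution_function F \<longleftrightarrow>
     mono F \<and> (\<forall>a. continuous (at_right a) F) \<and>
     (\<forall>x<0. F x = 0) \<and> (F \<longlongrightarrow> 1) at_top"

definition tail :: "(real \<Rightarrow> real) \<Rightarrow> real \<Rightarrow> real" where
  "tail F x = 1 - F x"

definition truncated_moment :: "(real \<Rightarrow> real) \<Rightarrow> real \<Rightarrow> real \<Rightarrow> real" where
  "truncated_moment F \<alpha> x = (LINT y:{0..x}|interval_measure F. y powr \<alpha>)"

definition tail_moment :: "(real \<Rightarrow> real) \<Rightarrow> real \<Rightarrow> real \<Rightarrow> real" where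
  "tail_moment F \<alpha> x = (LINT y:{0..x}|lborel. y powr (\<alpha> - 1) * tail F y)"

definition williamson :: "(real \<Rightarrow> real) \<Rightarrow> real \<Rightarrow> real \<Rightarrow> real" where
  "williamson F \<alpha> x = (LINT t:{0..x}|interval_measure F. 1 - (t / x) powr \<alpha>)"

text \<open>
  Since \<open>y / 0 = 0\<close>, a limit of \<open>1\<close> forces \<open>f\<close> to be nonzero for all large arguments; in
  particular, functions that vanish eventually are not regularly varying.
\<close>

definition RV :: "real \<Rightarrow> (real \<Rightarrow> real) set" where
  "RV \<rho> = {f. \<forall>t>0. ((\<lambda>x. f (t * x) / (t powr \<rho> * f x)) \<longlongrightarrow> 1) at_top}"

end

theory Submission
  imports Defs
begin

text \<open>
  Integration by parts gives \<open>H = \<alpha> W - x\<^sup>\<alpha> Fbar\<close>, hence \<open>Gbar = \<alpha> x\<^sup>-\<^sup>\<alpha> W\<close>, so that (b) is (c),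
  and each of (d), (f), (g), (h) expresses the convergence to \<open>\<theta>\<close> of the single ratio
  \<open>r = x\<^sup>\<alpha> Fbar / W\<close>. As \<open>Fbar\<close> is right-continuous, \<open>W\<close> and \<open>k = x\<^sup>-\<^sup>\<alpha> W\<close> have the right
  derivatives \<open>x\<^sup>\<alpha>\<^sup>-\<^sup>1 Fbar\<close> and \<open>- x\<^sup>-\<^sup>\<alpha>\<^sup>-\<^sup>1 H\<close> at every point, and one-sided derivatives suffice
  for l'Hopital's rule. The ratio \<open>r\<close> is the derivative of \<open>ln W\<close> with respect to \<open>ln x\<close>, so its
  convergence gives \<open>W \<in> RV \<theta>\<close>; the converse holds because \<open>Fbar\<close> is monotone. Regular variation
  of \<open>Fbar\<close> and of \<open>H\<close> is transferred to \<open>W\<close> by l'Hopital's rule for \<open>W (t x) / W x\<close> and for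
  \<open>k (t x) / k x\<close>; the former needs \<open>W\<close> to tend to infinity, which is where \<open>\<theta> > 0\<close> enters.
\<close>

section \<open>One-sided derivatives\<close>

text \<open>Tilting \<open>f\<close> by a small slope \<delta> makes every right derivative strictly
  positive. If the tilted function dropped over the interval, it would have to stay below the
  mid-level after the last point where it reaches it, against the strict increase to the right of
  that point. Finally \<epsilon> is arbitrary.\<close>

lemma right_derivative_nonneg_imp_le:
  fixes f f' :: "real \<Rightarrow> real"
  assumes "a \<le> b" and cont: "continuous_on {a..b} f"
    and der: "\<And>x. a < x \<Longrightarrow> x < b \<Longrightarrow> (f has_real_derivative f' x) (at_right x)"
    and nonneg: "\<And>x. a < x \<Longrightarrow> x < b \<Longrightarrow> 0 \<le> f' x"
  shows "f a \<le> f b"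
proof (rule field_le_epsilon)
  fix \<epsilon> :: real assume "\<epsilon> > 0"
  \<comment> \<open>The tilt adds at most \<epsilon> over the whole interval; the \<open>+ 1\<close>
    keeps the denominator positive when \<open>a = b\<close>.\<close>
  define \<delta> where "\<delta> = \<epsilon> / (b - a + 1)"
  have "\<delta> > 0" using \<open>\<epsilon> > 0\<close> \<open>a \<le> b\<close> by (simp add: \<delta>_def)
  define h where "h x = f x + \<delta> * (x - a)" for x
  have h_cont: "continuous_on {a..b} h"
    unfolding h_def by (intro continuous_intros cont)
  have "h a \<le> h b"
  proof (rule ccontr)
    assume less: "\<not> h a \<le> h b"
    define m where "m = (h a + h b) / 2"
    have m: "h b < m" "m < h a" using less by (simp_all add: m_def)
    define K where "K = {x \<in> {a..b}. m \<le> h x}"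
    have "closed K"
      unfolding K_def by (intro continuous_on_closed_Collect_le h_cont continuous_intros)
    moreover have "K \<subseteq> {a..b}" by (auto simp: K_def)
    ultimately have "compact K"
      using bounded_subset[OF bounded_closed_interval[of a b]] by (auto simp: compact_eq_bounded_closed)
    moreover obtain z where z: "a \<le> z" "z \<le> b" "h z = m"
      using IVT2'[of h b m a] m \<open>a \<le> b\<close> h_cont by auto
    then have "z \<in> K" by (simp add: K_def)
    \<comment> \<open>\<open>c\<close> is the last point at which \<open>h\<close> is at least
      \<open>m\<close>; it is interior because \<open>h b < m < h a\<close>.\<close>
    ultimately obtain c where c: "c \<in> K" "\<And>x. x \<in> K \<Longrightarrow> x \<le> c"
      using compact_attains_sup by (metis empty_iff)
    have "a < z" using z m by (auto simp: less_le)
    then have ineqs: "a < c" "c < b" "m \<le> h c"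
      using c(1) c(2)[OF \<open>z \<in> K\<close>] m by (auto simp: K_def less_le)
    have "(h has_real_derivative f' c + \<delta>) (at_right c)"
      unfolding h_def using der[OF ineqs(1,2)] by (auto intro!: derivative_eq_intros)
    moreover have "0 < f' c + \<delta>"
      using nonneg[OF ineqs(1,2)] \<open>\<delta> > 0\<close> by simp
    ultimately obtain d where d: "d > 0" "\<And>k. 0 < k \<Longrightarrow> c + k \<in> {c<..} \<Longrightarrow> k < d \<Longrightarrow> h c < h (c + k)"
      using has_real_derivative_pos_inc_right by blast
    define k where "k = min (d / 2) (b - c)"
    have k: "0 < k" "k < d" "c + k \<le> b"
      using d(1) ineqs by (auto simp: k_def min_def)
    have "h c < h (c + k)" using d(2) k by simp
    then have "c + k \<in> K" using ineqs k by (simp add: K_def)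
    with c(2)[of "c + k"] k show False by simp
  qed
  moreover have "\<delta> * (b - a) \<le> \<epsilon>"
    using \<open>\<epsilon> > 0\<close> \<open>a \<le> b\<close> by (simp add: \<delta>_def field_simps)
  ultimately show "f a \<le> f b + \<epsilon>" by (simp add: h_def)
qed

text \<open>This takes the place of Cauchy's mean value theorem. The monotonicity criterion is
  applied to \<open>g\<close>, to \<open>f + (\<epsilon> - L) * g\<close> and to
  \<open>- f + (\<epsilon> + L) * g\<close>, whose right derivatives are nonnegative from some
  \<open>X\<close> on.\<close>

lemma increments_of_right_derivative_quotient:
  fixes f g f' g' :: "real \<Rightarrow> real"
  assumes cont: "\<And>x. x > 0 \<Longrightarrow> isCont f x" "\<And>x. x > 0 \<Longrightarrow> isCont g x"
    and der: "\<And>x. x > 0 \<Longrightarrow> (f has_real_derivative f' x) (at_right x)"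
      "\<And>x. x > 0 \<Longrightarrow> (g has_real_derivative g' x) (at_right x)"
    and pos: "eventually (\<lambda>x. g' x > 0) at_top"
    and lim: "((\<lambda>x. f' x / g' x) \<longlongrightarrow> L) at_top"
    and "\<epsilon> > 0"
  shows "\<exists>X>0. \<forall>a b. X \<le> a \<longrightarrow> a \<le> b \<longrightarrow>
    0 \<le> g b - g a \<and> \<bar>f b - f a - L * (g b - g a)\<bar> \<le> \<epsilon> * (g b - g a)"
proof -
  have "eventually (\<lambda>x. dist (f' x / g' x) L < \<epsilon>) at_top"
    using lim \<open>\<epsilon> > 0\<close> by (rule tendstoD)
  then have "eventually (\<lambda>x. 0 < x \<and> 0 < g' x \<and> \<bar>f' x - L * g' x\<bar> \<le> \<epsilon> * g' x) at_top"
    using pos eventually_gt_at_top[of 0]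
  proof eventually_elim
    case (elim x)
    have "\<bar>f' x - L * g' x\<bar> = \<bar>f' x / g' x - L\<bar> * g' x"
      using elim by (simp add: field_simps abs_mult abs_if)
    also have "\<dots> \<le> \<epsilon> * g' x"
      using elim by (intro mult_right_mono) (auto simp: dist_real_def)
    finally show ?case using elim by blast
  qed
  then obtain X where X: "\<And>x. x \<ge> X \<Longrightarrow> 0 < x \<and> 0 < g' x \<and> \<bar>f' x - L * g' x\<bar> \<le> \<epsilon> * g' x"
    unfolding eventually_at_top_linorder by blast
  have "0 \<le> g b - g a \<and> \<bar>f b - f a - L * (g b - g a)\<bar> \<le> \<epsilon> * (g b - g a)"
    if "X \<le> a" "a \<le> b" for a b
  proof -
    have *: "p * f a + q * g a \<le> p * f b + q * g b"
      if "\<And>x. x \<ge> X \<Longrightarrow> 0 \<le> p * f' x + q * g' x" for p q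
    proof (rule right_derivative_nonneg_imp_le[OF \<open>a \<le> b\<close>, where f' = "\<lambda>x. p * f' x + q * g' x"])
      show "continuous_on {a..b} (\<lambda>x. p * f x + q * g x)"
        using X[OF \<open>X \<le> a\<close>] by (intro continuous_intros continuous_at_imp_continuous_on ballI cont) auto
      show "((\<lambda>x. p * f x + q * g x) has_real_derivative p * f' x + q * g' x) (at_right x)"
        if "a < x" for x
        using X[OF \<open>X \<le> a\<close>] that by (auto intro!: derivative_eq_intros der)
      show "0 \<le> p * f' x + q * g' x" if "a < x" for x
        using that \<open>X \<le> a\<close> by (intro \<open>\<And>x. x \<ge> X \<Longrightarrow> 0 \<le> p * f' x + q * g' x\<close>) simp
    qed
    have "g a \<le> g b"
      using *[of 0 1] X by (simp add: less_imp_le)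
    moreover have "f a + (\<epsilon> - L) * g a \<le> f b + (\<epsilon> - L) * g b"
    proof -
      have "0 \<le> 1 * f' x + (\<epsilon> - L) * g' x" if "x \<ge> X" for x
        using X[OF that] by (simp add: algebra_simps abs_le_iff)
      from *[OF this] show ?thesis by simp
    qed
    moreover have "- f a + (\<epsilon> + L) * g a \<le> - f b + (\<epsilon> + L) * g b"
    proof -
      have "0 \<le> -1 * f' x + (\<epsilon> + L) * g' x" if "x \<ge> X" for x
        using X[OF that] by (simp add: algebra_simps abs_le_iff)
      from *[OF this] show ?thesis by simp
    qed
    ultimately show ?thesis by (simp add: algebra_simps abs_le_iff)
  qed
  then show ?thesis
    using X[of X] by (intro exI[of _ X]) auto
qed

text \<open>In the increment estimate the left endpoint is frozen at \<open>X\<close>; the terms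
  coming from \<open>X\<close> are constant and are absorbed once \<open>g\<close> is large.\<close>

lemma lhopital_right_at_top:
  fixes f g f' g' :: "real \<Rightarrow> real"
  assumes "\<And>x. x > 0 \<Longrightarrow> isCont f x" "\<And>x. x > 0 \<Longrightarrow> isCont g x"
    and "\<And>x. x > 0 \<Longrightarrow> (f has_real_derivative f' x) (at_right x)"
      "\<And>x. x > 0 \<Longrightarrow> (g has_real_derivative g' x) (at_right x)"
    and "eventually (\<lambda>x. g' x > 0) at_top"
    and "((\<lambda>x. f' x / g' x) \<longlongrightarrow> L) at_top"
    and g_top: "filterlim g at_top at_top"
  shows "((\<lambda>x. f x / g x) \<longlongrightarrow> L) at_top"
proof (rule tendstoI)
  fix \<epsilon> :: real assume "\<epsilon> > 0"
  then have "\<epsilon> / 2 > 0" by simp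
  from increments_of_right_derivative_quotient[OF assms(1-6) this] obtain X where X: "X > 0" "\<And>a b. X \<le> a \<Longrightarrow> a \<le> b \<Longrightarrow>
      0 \<le> g b - g a \<and> \<bar>f b - f a - L * (g b - g a)\<bar> \<le> (\<epsilon> / 2) * (g b - g a)"
    by blast
  define C where "C = \<bar>f X - L * g X\<bar> + (\<epsilon> / 2) * \<bar>g X\<bar>"
  \<comment> \<open>Beyond \<open>2 * C / \<epsilon>\<close> the constant costs less than the second
    half of \<open>\<epsilon> * g x\<close>; the \<open>max 0\<close> makes \<open>g x\<close>
    positive for the division.\<close>
  have "eventually (\<lambda>x. g x > max 0 (2 * C / \<epsilon>)) at_top"
    using g_top unfolding filterlim_at_top_dense by blast
  then show "eventually (\<lambda>x. dist (f x / g x) L < \<epsilon>) at_top"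
    using eventually_ge_at_top[of X]
  proof eventually_elim
    case (elim x)
    have "\<bar>f x - L * g x\<bar> \<le> \<bar>f x - f X - L * (g x - g X)\<bar> + \<bar>f X - L * g X\<bar>"
      using abs_triangle_ineq[of "f x - f X - L * (g x - g X)" "f X - L * g X"]
      by (simp add: algebra_simps)
    also have "\<dots> \<le> (\<epsilon> / 2) * (g x - g X) + \<bar>f X - L * g X\<bar>"
      using X(2)[of X x] elim by auto
    also have "\<dots> \<le> (\<epsilon> / 2) * g x + C"
    proof -
      have "(\<epsilon> / 2) * (- g X) \<le> (\<epsilon> / 2) * \<bar>g X\<bar>"
        using \<open>\<epsilon> > 0\<close> by (intro mult_left_mono) auto
      then show ?thesis by (simp add: C_def algebra_simps)
    qed
    also have "\<dots> < \<epsilon> * g x"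
      using elim \<open>\<epsilon> > 0\<close> by (simp add: field_simps)
    finally have "\<bar>f x - L * g x\<bar> < \<epsilon> * g x" .
    moreover have "f x / g x - L = (f x - L * g x) / g x"
      using elim by (simp add: diff_divide_distrib)
    ultimately show ?case
      using elim by (simp add: dist_real_def pos_divide_less_eq)
  qed
qed

text \<open>For the form 0/0 the increment estimate is taken from \<open>x\<close> to
  \<open>b\<close> and \<open>b\<close> is sent to infinity, where \<open>f\<close> and
  \<open>g\<close> vanish.\<close>

lemma lhopital_right_at_top_0:
  fixes f g f' g' :: "real \<Rightarrow> real"
  assumes "\<And>x. x > 0 \<Longrightarrow> isCont f x" "\<And>x. x > 0 \<Longrightarrow> isCont g x"
    and "\<And>x. x > 0 \<Longrightarrow> (f has_real_derivative f' x) (at_right x)"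
      "\<And>x. x > 0 \<Longrightarrow> (g has_real_derivative g' x) (at_right x)"
    and "eventually (\<lambda>x. g' x > 0) at_top"
    and "((\<lambda>x. f' x / g' x) \<longlongrightarrow> L) at_top"
    and f_0: "(f \<longlongrightarrow> 0) at_top" and g_0: "(g \<longlongrightarrow> 0) at_top"
    and g_neq: "eventually (\<lambda>x. g x \<noteq> 0) at_top"
  shows "((\<lambda>x. f x / g x) \<longlongrightarrow> L) at_top"
proof (rule tendstoI)
  fix \<epsilon> :: real assume "\<epsilon> > 0"
  then have "\<epsilon> / 2 > 0" by simp
  from increments_of_right_derivative_quotient[OF assms(1-6) this] obtain X where X: "X > 0" "\<And>a b. X \<le> a \<Longrightarrow> a \<le> b \<Longrightarrow>
      0 \<le> g b - g a \<and> \<bar>f b - f a - L * (g b - g a)\<bar> \<le> (\<epsilon> / 2) * (g b - g a)"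
    by blast
  from g_neq eventually_ge_at_top[of X]
  show "eventually (\<lambda>x. dist (f x / g x) L < \<epsilon>) at_top"
  proof eventually_elim
    case (elim x)
    have "\<bar>0 - f x - L * (0 - g x)\<bar> \<le> (\<epsilon> / 2) * (0 - g x)"
    proof (rule tendsto_le)
      show "((\<lambda>b. (\<epsilon> / 2) * (g b - g x)) \<longlongrightarrow> (\<epsilon> / 2) * (0 - g x)) at_top"
        by (intro tendsto_intros g_0)
      show "((\<lambda>b. \<bar>f b - f x - L * (g b - g x)\<bar>) \<longlongrightarrow> \<bar>0 - f x - L * (0 - g x)\<bar>) at_top"
        by (intro tendsto_intros f_0 g_0)
      show "eventually (\<lambda>b. \<bar>f b - f x - L * (g b - g x)\<bar> \<le> (\<epsilon> / 2) * (g b - g x)) at_top"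
        using eventually_ge_at_top[of x] by eventually_elim (use X(2) elim in blast)
    qed simp
    then have *: "\<bar>L * g x - f x\<bar> \<le> (\<epsilon> / 2) * (- g x)" by simp
    \<comment> \<open>Dominating an absolute value fixes the sign: \<open>g\<close> rises to 0
      through nonzero values and is therefore negative.\<close>
    then have "0 \<le> (\<epsilon> / 2) * (- g x)" by linarith
    then have "g x < 0"
      using \<open>\<epsilon> > 0\<close> elim by (simp add: zero_le_mult_iff mult_le_0_iff)
    have "\<bar>f x / g x - L\<bar> = \<bar>L * g x - f x\<bar> / (- g x)"
      using \<open>g x < 0\<close> by (simp add: field_simps abs_if)
    also have "\<dots> \<le> \<epsilon> / 2"
      using * \<open>g x < 0\<close> by (simp add: field_simps)
    finally show ?case
      using \<open>\<epsilon> > 0\<close> by (simp add: dist_real_def)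
  qed
qed

section \<open>Regularly varying functions\<close>

lemma RV_iff_tendsto_ratio:
  assumes "eventually (\<lambda>x. f x \<noteq> 0) at_top"
  shows "f \<in> RV \<rho> \<longleftrightarrow> (\<forall>t>0. ((\<lambda>x. f (t * x) / f x) \<longlongrightarrow> t powr \<rho>) at_top)"
proof -
  have "((\<lambda>x. f (t * x) / (t powr \<rho> * f x)) \<longlongrightarrow> 1) at_top
      \<longleftrightarrow> ((\<lambda>x. f (t * x) / f x) \<longlongrightarrow> t powr \<rho>) at_top" (is "?l \<longleftrightarrow> ?r") if "t > 0" for t
  proof
    assume ?l
    from tendsto_mult_right[OF this, of "t powr \<rho>"] show ?r
      using that by (simp add: field_simps)
  next
    assume ?r
    from tendsto_divide[OF this tendsto_const, of "t powr \<rho>"] show ?l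
      using that by (simp add: field_simps)
  qed
  then show ?thesis by (simp add: RV_def)
qed

text \<open>Taking \<open>t = 1\<close> in the definition, \<open>f x / f x\<close> tends to 1,
  whereas it equals 0 wherever \<open>f\<close> vanishes.\<close>

lemma RV_eventually_nonzero:
  assumes "f \<in> RV \<rho>"
  shows "eventually (\<lambda>x. f x \<noteq> 0) at_top"
proof -
  have "((\<lambda>x. f (1 * x) / (1 powr \<rho> * f x)) \<longlongrightarrow> 1) at_top"
    using assms unfolding RV_def by (blast intro: zero_less_one)
  then have "eventually (\<lambda>x. f (1 * x) / (1 powr \<rho> * f x) > 0) at_top"
    by (rule order_tendstoD) simp
  then show ?thesis by eventually_elim auto
qed

lemma RV_ratio:
  assumes "f \<in> RV \<rho>" "t > 0"
  shows "((\<lambda>x. f (t * x) / f x) \<longlongrightarrow> t powr \<rho>) at_top"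
  using RV_iff_tendsto_ratio[OF RV_eventually_nonzero[OF assms(1)]] assms by blast

lemma filterlim_scale_at_top:
  "t > 0 \<Longrightarrow> filterlim (\<lambda>x :: real. t * x) at_top at_top"
  by (rule filterlim_tendsto_pos_mult_at_top[OF tendsto_const _ filterlim_ident])

text \<open>\<open>g (t * x) / g x\<close> factors through \<open>f\<close>: the ratios of
  \<open>g\<close> to \<open>f\<close> at \<open>t * x\<close> and at \<open>x\<close> both tend to
  \<open>c\<close> and cancel, leaving the ratio of \<open>f\<close>.\<close>

lemma RV_asymp:
  assumes f: "f \<in> RV \<rho>" and lim: "((\<lambda>x. g x / f x) \<longlongrightarrow> c) at_top" and "c \<noteq> 0"
  shows "g \<in> RV \<rho>"
proof -
  note f_neq = RV_eventually_nonzero[OF f]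
  have g_neq: "eventually (\<lambda>x. g x \<noteq> 0) at_top"
    using tendsto_imp_eventually_ne[OF lim \<open>c \<noteq> 0\<close>] by eventually_elim auto
  have "((\<lambda>x. g (t * x) / g x) \<longlongrightarrow> t powr \<rho>) at_top" if "t > 0" for t
  proof -
    note scale = filterlim_scale_at_top[OF that]
    have "((\<lambda>x. (g (t * x) / f (t * x)) * (f (t * x) / f x) / (g x / f x))
        \<longlongrightarrow> c * t powr \<rho> / c) at_top"
      by (intro tendsto_intros RV_ratio[OF f that] lim filterlim_compose[OF lim scale] \<open>c \<noteq> 0\<close>)
    moreover have "eventually (\<lambda>x. (g (t * x) / f (t * x)) * (f (t * x) / f x) / (g x / f x)
        = g (t * x) / g x) at_top"
      using f_neq g_neq eventually_compose_filterlim[OF f_neq scale]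
      by eventually_elim (auto simp: field_simps)
    ultimately show ?thesis
      using \<open>c \<noteq> 0\<close> by (auto intro: Lim_transform_eventually)
  qed
  then show ?thesis by (simp add: RV_iff_tendsto_ratio[OF g_neq])
qed

lemma RV_powr_mult:
  assumes "f \<in> RV \<rho>"
  shows "(\<lambda>x. x powr \<sigma> * f x) \<in> RV (\<sigma> + \<rho>)"
proof -
  note f_neq = RV_eventually_nonzero[OF assms]
  have neq: "eventually (\<lambda>x. x powr \<sigma> * f x \<noteq> 0) at_top"
    using f_neq eventually_gt_at_top[of 0] by eventually_elim auto
  have "((\<lambda>x. (t * x) powr \<sigma> * f (t * x) / (x powr \<sigma> * f x)) \<longlongrightarrow> t powr (\<sigma> + \<rho>)) at_top"
    if "t > 0" for t
  proof -
    have "((\<lambda>x. t powr \<sigma> * (f (t * x) / f x)) \<longlongrightarrow> t powr \<sigma> * t powr \<rho>) at_top"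
      by (intro tendsto_intros RV_ratio assms that)
    moreover have "eventually (\<lambda>x. t powr \<sigma> * (f (t * x) / f x)
        = (t * x) powr \<sigma> * f (t * x) / (x powr \<sigma> * f x)) at_top"
      using eventually_gt_at_top[of 0] by eventually_elim (use that in \<open>simp add: powr_mult\<close>)
    ultimately show ?thesis unfolding powr_add by (rule Lim_transform_eventually)
  qed
  then show ?thesis by (simp add: RV_iff_tendsto_ratio[OF neq])
qed

lemma RV_cong:
  assumes "eventually (\<lambda>x. f x = g x) at_top" "f \<in> RV \<rho>"
  shows "g \<in> RV \<rho>"
proof -
  have "eventually (\<lambda>x. g x / f x = 1) at_top"
    using assms(1) RV_eventually_nonzero[OF assms(2)] by eventually_elim auto
  then have "((\<lambda>x. g x / f x) \<longlongrightarrow> 1) at_top"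
    by (rule tendsto_eventually)
  then show ?thesis
    by (rule RV_asymp[OF assms(2)]) simp
qed

section \<open>Rescaled arguments and difference quotients of powers\<close>

lemma right_derivative_scale:
  fixes f :: "real \<Rightarrow> real"
  assumes "(f has_real_derivative D) (at_right (t * x))" "t > 0"
  shows "((\<lambda>x. f (t * x)) has_real_derivative D * t) (at_right x)"
proof -
  \<comment> \<open>Multiplication by a positive \<open>t\<close> maps a right neighbourhood onto a
    right neighbourhood, so the chain rule stays one-sided.\<close>
  have "(*) t ` {x<..} = {t * x<..}"
    using assms(2) by (auto simp: image_iff intro!: bexI[of _ "_ / t"] simp: field_simps)
  then show ?thesis
    using DERIV_image_chain[of f D "(*) t" x "{x<..}" t] assms
    by (auto simp: o_def intro!: derivative_eq_intros)
qed

lemma isCont_scale: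
  fixes f :: "real \<Rightarrow> real"
  assumes "isCont f (t * x)"
  shows "isCont (\<lambda>x. f (t * x)) x"
  using isCont_o2[of x "(*) t" f] assms by simp

text \<open>Numerator and denominator are difference quotients at 1 of two powers, with derivatives
  \<theta> and \<alpha>. This quotient arises as the limit of the bounds on \<open>r\<close>
  obtained from increments of \<open>W\<close>.\<close>

lemma tendsto_powr_difference_quotient:
  fixes \<theta> :: real assumes "\<alpha> > 0"
  shows "((\<lambda>t. \<alpha> * (t powr \<theta> - 1) / (t powr \<alpha> - 1)) \<longlongrightarrow> \<theta>) (at 1)"
proof -
  have der: "((\<lambda>t. (t powr c - 1) / (t - 1)) \<longlongrightarrow> c) (at 1)" for c :: real
  proof -
    have "((\<lambda>t. t powr c) has_real_derivative c * 1 powr (c - 1)) (at 1)"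
      by (rule has_real_derivative_powr) simp
    then show ?thesis by (simp add: has_field_derivative_iff)
  qed
  have "((\<lambda>t. \<alpha> * (((t powr \<theta> - 1) / (t - 1)) / ((t powr \<alpha> - 1) / (t - 1)))) \<longlongrightarrow> \<alpha> * (\<theta> / \<alpha>)) (at 1)"
    using assms by (intro tendsto_intros der) auto
  moreover have "eventually (\<lambda>t. \<alpha> * (((t powr \<theta> - 1) / (t - 1)) / ((t powr \<alpha> - 1) / (t - 1)))
      = \<alpha> * (t powr \<theta> - 1) / (t powr \<alpha> - 1)) (at (1 :: real))"
    by (auto simp: eventually_at_filter)
  ultimately have "((\<lambda>t. \<alpha> * (t powr \<theta> - 1) / (t powr \<alpha> - 1)) \<longlongrightarrow> \<alpha> * (\<theta> / \<alpha>)) (at 1)"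
    by (rule Lim_transform_eventually)
  then show ?thesis using assms by simp
qed

section \<open>Truncated moments and the Williamson transform\<close>

text \<open>\<open>F 0 = 0\<close> excludes an atom at the origin; with right-continuity it keeps
  \<open>Fbar\<close> close to 1 just to the right of 0, which makes \<open>W\<close>
  positive.\<close>

locale tail_on_nonneg =
  fixes F :: "real \<Rightarrow> real" and \<alpha> :: real
  assumes distribution: "nonneg_distribution_function F"
    and F_0 [simp]: "F 0 = 0"
    and \<alpha>_pos: "0 < \<alpha>"
begin

abbreviation "\<mu> \<equiv> interval_measure F"
abbreviation "Fbar \<equiv> tail F"
abbreviation "W \<equiv> tail_moment F \<alpha>"
abbreviation "H \<equiv> truncated_moment F \<alpha>"
abbreviation "Gbar \<equiv> tail (williamson F \<alpha>)"

section \<open>Elementary properties of the distribution function and its tail\<close>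

lemma mono_F: "mono F"
  and right_continuous_F: "continuous (at_right a) F"
  and F_eq_0: "x < 0 \<Longrightarrow> F x = 0"
  and F_tendsto_1: "(F \<longlongrightarrow> 1) at_top"
  using distribution unfolding nonneg_distribution_function_def by auto

lemma F_le_1: "F x \<le> 1"
  by (rule tendsto_lowerbound[OF F_tendsto_1])
     (auto intro: eventually_mono[OF eventually_ge_at_top[of x]] monoD[OF mono_F])

lemma F_nonneg: "0 \<le> F x"
  using monoD[OF mono_F, of "min x (-1)" x] F_eq_0[of "min x (-1)"] by simp

lemma Fbar_antimono: "x \<le> y \<Longrightarrow> Fbar y \<le> Fbar x"
  using monoD[OF mono_F] by (simp add: tail_def)

lemma Fbar_nonneg: "0 \<le> Fbar x" and Fbar_le_1: "Fbar x \<le> 1"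
  using F_le_1 F_nonneg by (simp_all add: tail_def)

lemma Fbar_tendsto_0: "(Fbar \<longlongrightarrow> 0) at_top"
  unfolding tail_def using tendsto_diff[OF tendsto_const F_tendsto_1, of 1] by simp

lemma Fbar_measurable [measurable]: "Fbar \<in> borel_measurable borel"
  unfolding tail_def using borel_measurable_mono[OF mono_F] by measurable

section \<open>The Stieltjes measure and the increments of the truncated moment\<close>

lemma emeasure_Ioc: "a \<le> b \<Longrightarrow> emeasure \<mu> {a<..b} = ennreal (F b - F a)"
  by (rule emeasure_interval_measure_Ioc) (auto simp: monoD[OF mono_F] right_continuous_F)

lemma measure_Ioc: "a \<le> b \<Longrightarrow> measure \<mu> {a<..b} = F b - F a"
  by (rule measure_interval_measure_Ioc) (auto simp: monoD[OF mono_F] right_continuous_F)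

text \<open>The point -1 stands for any negative number: a half-open interval starting there has
  known mass and contains the origin.\<close>

lemma emeasure_finite_of_subset:
  assumes "A \<subseteq> {-1<..x}" "0 \<le> x"
  shows "emeasure \<mu> A < \<infinity>"
proof -
  have "emeasure \<mu> A \<le> emeasure \<mu> {-1<..x}"
    using assms by (intro emeasure_mono) auto
  also have "\<dots> < \<infinity>"
    using assms(2) by (simp add: emeasure_Ioc)
  finally show ?thesis .
qed

text \<open>The closed interval lies between \<open>{0<..x}\<close> and \<open>{-1<..x}\<close>,
  which both have mass \<open>F x\<close> because \<open>F\<close> is 0 at 0 and at -1.\<close>

lemma measure_Icc_0:
  assumes "0 \<le> x"
  shows "measure \<mu> {0..x} = F x"
proof (rule antisym)
  have "measure \<mu> {0..x} \<le> measure \<mu> {-1<..x}"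
    using assms emeasure_finite_of_subset[of "{-1<..x}" x]
    by (intro measure_mono_fmeasurable) (auto simp: fmeasurable_def)
  also have "\<dots> = F x" using assms by (simp add: measure_Ioc F_eq_0)
  finally show "measure \<mu> {0..x} \<le> F x" .
  have "F x = measure \<mu> {0<..x}" using assms by (simp add: measure_Ioc)
  also have "\<dots> \<le> measure \<mu> {0..x}"
    using assms by (intro measure_mono_fmeasurable)
      (auto simp: fmeasurable_def intro!: emeasure_finite_of_subset[of _ x, unfolded infinity_ennreal_def])
  finally show "F x \<le> measure \<mu> {0..x}" .
qed

lemma powr_set_integrable:
  assumes "A \<in> sets borel" "A \<subseteq> {0..x}" "0 \<le> x"
  shows "set_integrable \<mu> A (\<lambda>y. y powr \<alpha>)"
  unfolding set_integrable_def
proof (rule integrableI_bounded_set[where A = A and B = "x powr \<alpha>"])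
  show "emeasure \<mu> A < \<infinity>"
    using assms by (intro emeasure_finite_of_subset[of _ x]) auto
  show "AE y in \<mu>. y \<in> A \<longrightarrow> norm (indicator A y *\<^sub>R y powr \<alpha>) \<le> x powr \<alpha>"
    using assms \<alpha>_pos by (auto intro!: AE_I2 powr_mono2)
qed (use assms in auto)

text \<open>On \<open>{a<..b}\<close> the integrand lies between its endpoint values, and the
  interval has mass \<open>F b - F a\<close>.\<close>

lemma H_increment:
  assumes "0 \<le> a" "a \<le> b"
  shows "a powr \<alpha> * (F b - F a) \<le> H b - H a"
    and "H b - H a \<le> b powr \<alpha> * (F b - F a)"
proof -
  have "{0..b} = {0..a} \<union> {a<..b}" using assms by auto
  then have "H b = H a + (LINT y:{a<..b}|\<mu>. y powr \<alpha>)"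
    unfolding truncated_moment_def using assms
    by (auto intro!: set_integral_Un powr_set_integrable[of _ b])
  then have H: "H b - H a = (LINT y:{a<..b}|\<mu>. y powr \<alpha>)" by simp
  have fin: "emeasure \<mu> {a<..b} < \<infinity>"
    using assms by (intro emeasure_finite_of_subset[of _ b]) auto
  have const: "set_integrable \<mu> {a<..b} (\<lambda>_. c :: real)"
      "(LINT y:{a<..b}|\<mu>. c) = c * (F b - F a)" for c
    using fin set_integral_const[of "{a<..b}" \<mu> c] measure_Ioc[OF assms(2)]
    by (auto simp: set_integrable_def)
  have powr: "set_integrable \<mu> {a<..b} (\<lambda>y. y powr \<alpha>)"
    using assms by (intro powr_set_integrable[of _ b]) auto
  show "a powr \<alpha> * (F b - F a) \<le> H b - H a"
    using set_integral_mono[OF const(1) powr, of "a powr \<alpha>"] assms \<alpha>_pos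
    by (simp add: H const(2) powr_mono2)
  show "H b - H a \<le> b powr \<alpha> * (F b - F a)"
    using set_integral_mono[OF powr const(1), of "b powr \<alpha>"] assms \<alpha>_pos
    by (simp add: H const(2) powr_mono2)
qed

lemma H_0: "H 0 = 0"
proof -
  have "H 0 = (LINT y:{0..0}|\<mu>. 0)"
    unfolding truncated_moment_def by (rule set_lebesgue_integral_cong) auto
  then show ?thesis by simp
qed

section \<open>The tail moment as a continuous, right-differentiable integral\<close>

lemma integrand_set_integrable:
  assumes "0 \<le> x"
  shows "set_integrable lborel {0..x} (\<lambda>y. y powr (\<alpha> - 1) * Fbar y)"
proof (rule set_integrable_bound)
  \<comment> \<open>Since \<open>Fbar\<close> is at most 1, the pure power dominates; it is
    integrable at the origin because \<alpha> is positive.\<close>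
  have "(\<lambda>y. y powr (\<alpha> - 1)) integrable_on {0..x}"
    using has_integral_powr_from_0[of "\<alpha> - 1" x] \<alpha>_pos assms by auto
  then have "(\<lambda>y. y powr (\<alpha> - 1)) absolutely_integrable_on {0..x}"
    by (rule nonnegative_absolutely_integrable_1) auto
  then show "set_integrable lborel {0..x} (\<lambda>y. y powr (\<alpha> - 1))"
    unfolding set_integrable_def by (subst (asm) integrable_completion) auto
  show "set_borel_measurable lborel {0..x} (\<lambda>y. y powr (\<alpha> - 1) * Fbar y)"
    unfolding set_borel_measurable_def by measurable
  show "AE y in lborel. y \<in> {0..x} \<longrightarrow> norm (y powr (\<alpha> - 1) * Fbar y) \<le> norm (y powr (\<alpha> - 1))"
    using Fbar_nonneg Fbar_le_1 by (auto intro!: AE_I2 mult_left_le simp: abs_mult)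
qed

lemma integrand_integrable: "0 \<le> x \<Longrightarrow> (\<lambda>y. y powr (\<alpha> - 1) * Fbar y) integrable_on {0..x}"
  by (intro set_borel_integral_eq_integral integrand_set_integrable)

lemma W_eq_integral: "0 \<le> x \<Longrightarrow> W x = integral {0..x} (\<lambda>y. y powr (\<alpha> - 1) * Fbar y)"
  unfolding tail_moment_def by (intro set_borel_integral_eq_integral integrand_set_integrable)

lemma continuous_on_W: "continuous_on {0..b} W"
proof (cases "0 \<le> b")
  case True
  show ?thesis
    by (rule continuous_on_eq[OF indefinite_integral_continuous_1[OF integrand_integrable[OF True]]])
       (simp add: W_eq_integral)
qed simp

lemma isCont_W:
  assumes "0 < x"
  shows "isCont W x"
proof -
  have "continuous_on {0<..<x + 1} W"
    by (rule continuous_on_subset[OF continuous_on_W[of "x + 1"]]) auto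
  then show ?thesis using assms by (simp add: continuous_on_eq_continuous_at)
qed

text \<open>\<open>Fbar\<close> is only right-continuous, so the fundamental theorem of calculus is
  applied on \<open>{x..x + 1}\<close> at its left endpoint, and the integral up to \<open>x\<close>
  is added back.\<close>

lemma W_right_derivative:
  assumes "0 < x"
  shows "(W has_real_derivative x powr (\<alpha> - 1) * Fbar x) (at_right x)"
proof -
  let ?f = "\<lambda>y. y powr (\<alpha> - 1) * Fbar y"
  have at: "at x within {x..x + 1} = at_right x"
    by (rule at_within_Icc_at_right) simp
  have "((\<lambda>u. integral {x..u} ?f) has_vector_derivative ?f x) (at x within ({x..x + 1} - {}))"
  proof (rule integral_has_vector_derivative_continuous_at)
    show "?f integrable_on {x..x + 1}"
      using assms by (intro integrable_subinterval_real[OF integrand_integrable[of "x + 1"]]) auto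
    show "continuous (at x within {x..x + 1} - {}) ?f"
      using assms right_continuous_F[of x]
      unfolding tail_def Diff_empty at continuous_within by (auto intro!: tendsto_intros)
  qed auto
  then have "((\<lambda>u. W x + integral {x..u} ?f) has_real_derivative ?f x) (at_right x)"
    by (auto simp: at has_real_derivative_iff_has_vector_derivative intro!: derivative_eq_intros)
  moreover have "eventually (\<lambda>u. W x + integral {x..u} ?f = W u) (at_right x)"
    using eventually_at_right_less[of x]
  proof eventually_elim
    case (elim u)
    then show ?case
      using assms Henstock_Kurzweil_Integration.integral_combine[OF _ _ integrand_integrable[of u], of x]
      by (simp add: W_eq_integral)
  qed
  ultimately show ?thesis
    by (rule has_field_derivative_cong_eventually[THEN iffD1, rotated 2]) simp
qed

text \<open>\<open>Fbar\<close> is antitone, so on the interval it lies between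
  \<open>Fbar b\<close> and \<open>Fbar a\<close>; comparing \<open>\<alpha> * W\<close> with these
  multiples of \<open>x powr \<alpha>\<close> by right derivatives gives both bounds.\<close>

lemma W_increment:
  assumes "0 \<le> a" "a \<le> b"
  shows "Fbar b * (b powr \<alpha> - a powr \<alpha>) \<le> \<alpha> * (W b - W a)"
    and "\<alpha> * (W b - W a) \<le> Fbar a * (b powr \<alpha> - a powr \<alpha>)"
proof -
  have cont: "continuous_on {a..b} (\<lambda>x. c * x powr \<alpha> - d * W x)" for c d
    using assms \<alpha>_pos by (intro continuous_intros continuous_on_powr' continuous_on_subset[OF continuous_on_W[of b]]) auto
  have der: "((\<lambda>x. c * x powr \<alpha> - d * W x) has_real_derivative
      c * (\<alpha> * x powr (\<alpha> - 1)) - d * (x powr (\<alpha> - 1) * Fbar x)) (at_right x)" if "a < x" for c d x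
    using that assms
    by (intro DERIV_diff DERIV_cmult W_right_derivative
        has_field_derivative_at_within[OF has_real_derivative_powr]) auto
  have "Fbar a * a powr \<alpha> - \<alpha> * W a \<le> Fbar a * b powr \<alpha> - \<alpha> * W b"
    by (rule right_derivative_nonneg_imp_le[OF assms(2) cont der])
       (use \<alpha>_pos Fbar_antimono in \<open>auto simp: mult.left_commute[of "Fbar a"] mult.commute[of "Fbar a"] intro!: mult_left_mono\<close>)
  then show "\<alpha> * (W b - W a) \<le> Fbar a * (b powr \<alpha> - a powr \<alpha>)"
    by (simp add: algebra_simps)
  have "(- Fbar b) * a powr \<alpha> - (- \<alpha>) * W a \<le> (- Fbar b) * b powr \<alpha> - (- \<alpha>) * W b"
    by (rule right_derivative_nonneg_imp_le[OF assms(2) cont der])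
       (use \<alpha>_pos Fbar_antimono in \<open>auto simp: mult.left_commute[of "Fbar b"] mult.commute[of "Fbar b"] intro!: mult_left_mono\<close>)
  then show "Fbar b * (b powr \<alpha> - a powr \<alpha>) \<le> \<alpha> * (W b - W a)"
    by (simp add: algebra_simps)
qed

lemma W_0: "W 0 = 0"
  by (simp add: W_eq_integral)

lemma W_mono:
  assumes "0 \<le> x" "x \<le> y"
  shows "W x \<le> W y"
proof -
  have "0 \<le> Fbar y * (y powr \<alpha> - x powr \<alpha>)"
    using assms \<alpha>_pos by (intro mult_nonneg_nonneg Fbar_nonneg) (auto intro: powr_mono2)
  then have "0 \<le> \<alpha> * (W y - W x)"
    using W_increment(1)[OF assms] by simp
  then show ?thesis using \<alpha>_pos by (simp add: zero_le_mult_iff)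
qed

lemma Fbar_near_0:
  assumes "0 < x"
  shows "\<exists>y. 0 < y \<and> y \<le> x \<and> 1 / 2 < Fbar y"
proof -
  have "(Fbar \<longlongrightarrow> 1) (at_right 0)"
    using right_continuous_F[of 0] tendsto_diff[OF tendsto_const, of F 0 "at_right 0" 1]
    by (simp add: tail_def[abs_def] continuous_within)
  then have "eventually (\<lambda>y. 1 / 2 < Fbar y) (at_right 0)"
    by (rule order_tendstoD) simp
  then have "eventually (\<lambda>y. 0 < y \<and> y \<le> x \<and> 1 / 2 < Fbar y) (at_right 0)"
    using eventually_at_right_real[OF assms] by eventually_elim auto
  then show ?thesis
    using eventually_happens trivial_limit_at_right_real by blast
qed

lemma W_pos:
  assumes "0 < x"
  shows "0 < W x"
proof -
  obtain y where y: "0 < y" "y \<le> x" "1 / 2 < Fbar y"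
    using Fbar_near_0[OF assms] by blast
  have "0 < Fbar y * (y powr \<alpha> - 0 powr \<alpha>)" using y by simp
  also have "\<dots> \<le> \<alpha> * (W y - W 0)" using y by (intro W_increment) auto
  also have "\<dots> = \<alpha> * W y" by (simp add: W_0)
  finally have "0 < W y" using \<alpha>_pos by (simp add: zero_less_mult_iff)
  also have "W y \<le> W x" using y by (intro W_mono) auto
  finally show ?thesis .
qed

text \<open>\<open>F\<close> is below 1/2 at some positive \<open>y\<close> and eventually above
  1/2, so there is mass to the right of \<open>y\<close>, where the integrand is at least
  \<open>y powr \<alpha>\<close>.\<close>

lemma H_pos: "eventually (\<lambda>x. 0 < H x) at_top"
proof -
  obtain y where y: "0 < y" "1 / 2 < Fbar y"
    using Fbar_near_0[of 1] by auto
  have "0 \<le> H y"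
    using H_increment(1)[of 0 y] y by (simp add: H_0)
  have "eventually (\<lambda>x. 1 / 2 < F x) at_top"
    using F_tendsto_1 by (rule order_tendstoD) simp
  then show ?thesis
    using eventually_ge_at_top[of y]
  proof eventually_elim
    case (elim x)
    have "0 < y powr \<alpha> * (F x - F y)"
      using elim y by (simp add: tail_def)
    also have "\<dots> \<le> H x - H y"
      using elim y by (intro H_increment) auto
    finally show ?case using \<open>0 \<le> H y\<close> by simp
  qed
qed

text \<open>
  Both sides have increments over \<open>(a, b]\<close> that agree up to
  \<open>(b powr \<alpha> - a powr \<alpha>) * (F b - F a)\<close>; summing over a partition that is equidistant
  in \<open>y powr \<alpha>\<close> replaces Stieltjes integration by parts.
\<close>

lemma H_eq:
  assumes "0 \<le> x"
  shows "H x = \<alpha> * W x - x powr \<alpha> * Fbar x"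
proof -
  define \<Phi> where "\<Phi> y = H y - (\<alpha> * W y - y powr \<alpha> * Fbar y)" for y
  have incr: "\<bar>\<Phi> b - \<Phi> a\<bar> \<le> (b powr \<alpha> - a powr \<alpha>) * (F b - F a)" if "0 \<le> a" "a \<le> b" for a b
    using H_increment[OF that] W_increment[OF that]
    unfolding \<Phi>_def tail_def by (simp add: algebra_simps abs_le_iff)
  define u where "u n i = x * (real i / real n) powr (1 / \<alpha>)" for n i :: nat
  have u_powr: "u n i powr \<alpha> = x powr \<alpha> * (real i / real n)" for n i
    using assms \<alpha>_pos by (simp add: u_def powr_mult powr_powr)
  have u_mono: "u n i \<le> u n (Suc i)" for n i
    unfolding u_def using assms \<alpha>_pos
    by (intro mult_left_mono powr_mono2 divide_right_mono) auto
  \<comment> \<open>All steps of the partition have the same increment of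
    \<open>y powr \<alpha>\<close>, so the error bounds telescope to a multiple of \<open>F\<close>,
    which is at most 1.\<close>
  have bound: "\<bar>\<Phi> (u n k)\<bar> \<le> x powr \<alpha> / real n * F (u n k)" for n k
  proof (induction k)
    case 0
    then show ?case using \<alpha>_pos by (simp add: u_def \<Phi>_def H_0 W_0)
  next
    case (Suc k)
    have "0 \<le> u n k" using assms by (simp add: u_def)
    from incr[OF this u_mono]
    have "\<bar>\<Phi> (u n (Suc k)) - \<Phi> (u n k)\<bar> \<le> x powr \<alpha> / real n * (F (u n (Suc k)) - F (u n k))"
      unfolding u_powr by (simp add: add_divide_distrib distrib_left)
    then have "\<bar>\<Phi> (u n (Suc k))\<bar> \<le> \<bar>\<Phi> (u n k)\<bar> + x powr \<alpha> / real n * (F (u n (Suc k)) - F (u n k))"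
      by linarith
    with Suc.IH show ?case by (simp add: right_diff_distrib)
  qed
  have "\<bar>\<Phi> x\<bar> \<le> x powr \<alpha> / real n" if "n > 0" for n
  proof -
    have "\<bar>\<Phi> x\<bar> \<le> x powr \<alpha> / real n * F x"
      using bound[of n n] that by (simp add: u_def)
    also have "\<dots> \<le> x powr \<alpha> / real n"
      using F_le_1 F_nonneg by (intro mult_left_le) auto
    finally show ?thesis .
  qed
  moreover have "(\<lambda>n. x powr \<alpha> / real n) \<longlonglongrightarrow> 0"
    by (rule lim_const_over_n)
  ultimately have "\<bar>\<Phi> x\<bar> \<le> 0"
    by (intro tendsto_lowerbound[of _ 0 sequentially]) (auto intro: eventually_mono[OF eventually_gt_at_top[of 0]])
  then show ?thesis by (simp add: \<Phi>_def)
qed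

text \<open>Expanding the kernel gives \<open>Gbar x = Fbar x + x powr - \<alpha> * H x\<close>;
  inserting the formula for \<open>H\<close> cancels \<open>Fbar\<close>.\<close>

lemma Gbar_eq:
  assumes "0 < x"
  shows "Gbar x = \<alpha> * (x powr - \<alpha> * W x)"
proof -
  have fin: "emeasure \<mu> {0..x} < \<infinity>"
    using assms by (intro emeasure_finite_of_subset[of _ x]) auto
  have "williamson F \<alpha> x = (LINT t:{0..x}|\<mu>. 1 - x powr - \<alpha> * t powr \<alpha>)"
    unfolding williamson_def using assms
    by (intro set_lebesgue_integral_cong) (auto simp: powr_divide powr_minus field_simps)
  also have "\<dots> = (LINT t:{0..x}|\<mu>. 1) - (LINT t:{0..x}|\<mu>. x powr - \<alpha> * t powr \<alpha>)"
    using fin assms powr_set_integrable[of "{0..x}" x]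
    by (intro set_integral_diff set_integrable_mult_right) (auto simp: set_integrable_def)
  also have "\<dots> = F x - x powr - \<alpha> * H x"
    using fin assms set_integral_const[of "{0..x}" \<mu> "1 :: real"]
    by (simp add: measure_Icc_0 truncated_moment_def)
  finally have "Gbar x = Fbar x + x powr - \<alpha> * H x" by (simp add: tail_def)
  then show ?thesis
    using assms by (simp add: H_eq algebra_simps powr_minus)
qed

section \<open>Karamata theory for the tail moment\<close>

definition r :: "real \<Rightarrow> real" where
  "r x = x powr \<alpha> * Fbar x / W x"

lemma eventually_W_neq_0: "eventually (\<lambda>x. W x \<noteq> 0) at_top"
  using eventually_gt_at_top[of 0] by eventually_elim (use W_pos in force)

text \<open>\<open>Gbar\<close> is a constant times \<open>x powr - \<alpha> * W x\<close>, and a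
  power factor only shifts the index.\<close>

lemma Gbar_RV_iff: "Gbar \<in> RV (\<theta> - \<alpha>) \<longleftrightarrow> W \<in> RV \<theta>"
proof
  assume "Gbar \<in> RV (\<theta> - \<alpha>)"
  then have *: "(\<lambda>x. x powr \<alpha> * Gbar x) \<in> RV \<theta>"
    using RV_powr_mult[of Gbar "\<theta> - \<alpha>" \<alpha>] by simp
  have "eventually (\<lambda>x. W x / (x powr \<alpha> * Gbar x) = 1 / \<alpha>) at_top"
    using eventually_gt_at_top[of 0] eventually_W_neq_0
    by eventually_elim (simp add: Gbar_eq powr_minus field_simps)
  then show "W \<in> RV \<theta>"
    using \<alpha>_pos by (intro RV_asymp[OF * tendsto_eventually]) auto
next
  assume "W \<in> RV \<theta>"
  then have *: "(\<lambda>x. x powr - \<alpha> * W x) \<in> RV (\<theta> - \<alpha>)"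
    using RV_powr_mult[of W \<theta> "- \<alpha>"] by simp
  have "eventually (\<lambda>x. Gbar x / (x powr - \<alpha> * W x) = \<alpha>) at_top"
    using eventually_gt_at_top[of 0] eventually_W_neq_0
    by eventually_elim (simp add: Gbar_eq)
  then show "Gbar \<in> RV (\<theta> - \<alpha>)"
    using \<alpha>_pos by (intro RV_asymp[OF * tendsto_eventually]) auto
qed

text \<open>A monotone density argument: increments of \<open>W\<close> between \<open>x\<close> and
  \<open>t * x\<close> bound \<open>r x\<close> from below for \<open>t > 1\<close> and from above
  for \<open>t < 1\<close>. Both bounds tend to \<open>q t\<close> as \<open>x\<close> grows, and
  \<open>q t\<close> tends to \<theta> as \<open>t\<close> tends to 1.\<close>

lemma r_tendsto_if_W_RV:
  assumes W: "W \<in> RV \<theta>"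
  shows "(r \<longlongrightarrow> \<theta>) at_top"
proof -
  define q where "q t = \<alpha> * (t powr \<theta> - 1) / (t powr \<alpha> - 1)" for t
  have q: "(q \<longlongrightarrow> \<theta>) (at 1)"
    unfolding q_def using \<alpha>_pos by (rule tendsto_powr_difference_quotient)
  have Q: "((\<lambda>x. \<alpha> * (W (t * x) / W x - 1) / (t powr \<alpha> - 1)) \<longlongrightarrow> q t) at_top"
    if "t > 0" "t \<noteq> 1" for t
  proof -
    have "t powr \<alpha> \<noteq> 1" using that \<alpha>_pos by simp
    then show ?thesis
      unfolding q_def by (intro tendsto_intros RV_ratio[OF W \<open>t > 0\<close>]) auto
  qed
  \<comment> \<open>To the right of \<open>x\<close> the tail is at most
    \<open>Fbar x\<close>.\<close>
  have lower: "\<alpha> * (W (t * x) / W x - 1) / (t powr \<alpha> - 1) \<le> r x" if "t > 1" "x > 0" for t x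
  proof -
    have "\<alpha> * (W (t * x) - W x) \<le> Fbar x * ((t * x) powr \<alpha> - x powr \<alpha>)"
      using that by (intro W_increment) auto
    also have "\<dots> = (t powr \<alpha> - 1) * (x powr \<alpha> * Fbar x)"
      using that by (simp add: powr_mult algebra_simps)
    finally have "\<alpha> * (W (t * x) - W x) / W x \<le> (t powr \<alpha> - 1) * (x powr \<alpha> * Fbar x) / W x"
      using W_pos[OF \<open>x > 0\<close>] by (intro divide_right_mono) auto
    moreover have "\<alpha> * (W (t * x) - W x) / W x = \<alpha> * (W (t * x) / W x - 1)"
      using W_pos[OF \<open>x > 0\<close>] by (simp add: field_simps)
    moreover have "t powr \<alpha> > 1" using that \<alpha>_pos by simp
    ultimately show ?thesis
      by (simp add: r_def pos_divide_le_eq mult.commute)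
  qed
  \<comment> \<open>To the left of \<open>x\<close> the tail is at least \<open>Fbar x\<close>; the
    final division is by the negative number \<open>t powr \<alpha> - 1\<close>, which turns the
    inequality around.\<close>
  have upper: "r x \<le> \<alpha> * (W (t * x) / W x - 1) / (t powr \<alpha> - 1)" if "0 < t" "t < 1" "x > 0" for t x
  proof -
    have "Fbar x * (x powr \<alpha> - (t * x) powr \<alpha>) \<le> \<alpha> * (W x - W (t * x))"
      using that by (intro W_increment) (auto simp: mult_le_cancel_right1)
    moreover have "Fbar x * (x powr \<alpha> - (t * x) powr \<alpha>) = (1 - t powr \<alpha>) * (x powr \<alpha> * Fbar x)"
      using that by (simp add: powr_mult algebra_simps)
    ultimately have "(1 - t powr \<alpha>) * (x powr \<alpha> * Fbar x) / W x \<le> \<alpha> * (W x - W (t * x)) / W x"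
      using W_pos[OF \<open>x > 0\<close>] by (intro divide_right_mono) auto
    moreover have "\<alpha> * (W x - W (t * x)) / W x = - (\<alpha> * (W (t * x) / W x - 1))"
      using W_pos[OF \<open>x > 0\<close>] by (simp add: field_simps)
    ultimately have "\<alpha> * (W (t * x) / W x - 1) \<le> (t powr \<alpha> - 1) * r x"
      by (simp add: r_def algebra_simps diff_divide_distrib)
    moreover have "t powr \<alpha> < 1" using powr_less_mono2[of \<alpha> t 1] that \<alpha>_pos by simp
    ultimately show ?thesis
      by (simp add: neg_le_divide_eq mult.commute)
  qed
  show ?thesis
  proof (rule order_tendstoI)
    \<comment> \<open>First fix \<open>t\<close> so near to 1 that \<open>q t\<close> is still above
      \<open>c\<close>; only then let \<open>x\<close> grow.\<close>
    fix c assume "c < \<theta>"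
    then have "eventually (\<lambda>t. c < q t) (at_right 1)"
      using q by (intro order_tendstoD) (auto simp: filterlim_at_split)
    then have "eventually (\<lambda>t. 1 < t \<and> c < q t) (at_right 1)"
      using eventually_at_right_less[of "1 :: real"] by eventually_elim auto
    then obtain t where t: "1 < t" "c < q t"
      using eventually_happens trivial_limit_at_right_real by blast
    have "eventually (\<lambda>x. c < \<alpha> * (W (t * x) / W x - 1) / (t powr \<alpha> - 1)) at_top"
      using order_tendstoD(1)[OF Q t(2)] t by auto
    then show "eventually (\<lambda>x. c < r x) at_top"
      using eventually_gt_at_top[of 0] by eventually_elim (use lower[OF t(1)] in fastforce)
  next
    fix c assume "\<theta> < c"
    then have "eventually (\<lambda>t. q t < c) (at_left 1)"
      using q by (intro order_tendstoD) (auto simp: filterlim_at_split)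
    moreover have "eventually (\<lambda>t. t \<in> {0<..<1}) (at_left (1 :: real))"
      by (rule eventually_at_left_real) simp
    ultimately have "eventually (\<lambda>t. 0 < t \<and> t < 1 \<and> q t < c) (at_left 1)"
      by eventually_elim auto
    then obtain t where t: "0 < t" "t < 1" "q t < c"
      using eventually_happens trivial_limit_at_left_real by blast
    have "eventually (\<lambda>x. \<alpha> * (W (t * x) / W x - 1) / (t powr \<alpha> - 1) < c) at_top"
      using order_tendstoD(2)[OF Q t(3)] t by auto
    then show "eventually (\<lambda>x. r x < c) at_top"
      using eventually_gt_at_top[of 0] by eventually_elim (use upper[OF t(1,2)] in fastforce)
  qed
qed

text \<open>The increment estimate for \<open>ln W\<close> against \<open>ln\<close> gives that
  \<open>ln (W (t * x)) - ln (W x)\<close> is close to \<open>\<theta> * ln t\<close>;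
  exponentiating yields the ratio.\<close>

lemma W_RV_if_r_tendsto:
  assumes lim: "(r \<longlongrightarrow> \<theta>) at_top"
  shows "W \<in> RV \<theta>"
proof -
  have cont: "isCont (\<lambda>x. ln (W x)) x" if "x > 0" for x
    using W_pos[OF that] by (intro continuous_intros isCont_W that) auto
  have der: "((\<lambda>x. ln (W x)) has_real_derivative (1 / W x) * (x powr (\<alpha> - 1) * Fbar x)) (at_right x)"
    if "x > 0" for x
    using that by (intro DERIV_chain'[OF W_right_derivative DERIV_ln_divide] W_pos)
  have ln: "isCont ln x" "(ln has_real_derivative 1 / x) (at_right x)" if "x > 0" for x :: real
    using that by (auto intro: has_field_derivative_at_within[OF DERIV_ln_divide] DERIV_isCont[OF DERIV_ln_divide])
  have ln_der_pos: "eventually (\<lambda>x :: real. 0 < 1 / x) at_top"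
    using eventually_gt_at_top[of 0] by eventually_elim simp
  have quot: "((\<lambda>x. ((1 / W x) * (x powr (\<alpha> - 1) * Fbar x)) / (1 / x)) \<longlongrightarrow> \<theta>) at_top"
  proof (rule Lim_transform_eventually[OF lim])
    show "eventually (\<lambda>x. r x = ((1 / W x) * (x powr (\<alpha> - 1) * Fbar x)) / (1 / x)) at_top"
      using eventually_gt_at_top[of 0]
      by eventually_elim (simp add: r_def powr_diff)
  qed
  have "((\<lambda>x. ln (W (t * x)) - ln (W x)) \<longlongrightarrow> \<theta> * ln t) at_top" if "t > 0" for t
  proof (rule tendstoI)
    fix \<epsilon> :: real assume "\<epsilon> > 0"
    define \<delta> where "\<delta> = \<epsilon> / (\<bar>ln t\<bar> + 1)"
    have "\<delta> > 0" using \<open>\<epsilon> > 0\<close> by (simp add: \<delta>_def)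
    obtain X where X: "X > 0" "\<And>a b. X \<le> a \<Longrightarrow> a \<le> b \<Longrightarrow>
        \<bar>ln (W b) - ln (W a) - \<theta> * (ln b - ln a)\<bar> \<le> \<delta> * (ln b - ln a)"
      using increments_of_right_derivative_quotient[OF cont ln(1) der ln(2) ln_der_pos quot \<open>\<delta> > 0\<close>] by blast
    \<comment> \<open>A version symmetric in the endpoints, since \<open>t * x\<close> lies to the
      left of \<open>x\<close> when \<open>t < 1\<close>.\<close>
    have X': "\<bar>ln (W b) - ln (W a) - \<theta> * (ln b - ln a)\<bar> \<le> \<delta> * \<bar>ln b - ln a\<bar>"
      if "X \<le> a" "X \<le> b" for a b
    proof (cases "a \<le> b")
      case True
      then show ?thesis using X(2)[of a b] X(1) that by simp
    next
      case False
      have "ln (W b) - ln (W a) - \<theta> * (ln b - ln a) = - (ln (W a) - ln (W b) - \<theta> * (ln a - ln b))"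
        by (simp add: algebra_simps)
      then have "\<bar>ln (W b) - ln (W a) - \<theta> * (ln b - ln a)\<bar> \<le> \<delta> * (ln a - ln b)"
        using X(2)[of b a] that False by (simp only: abs_minus_cancel)
      also have "\<dots> = \<delta> * \<bar>ln b - ln a\<bar>"
        using False X(1) that by simp
      finally show ?thesis .
    qed
    have "eventually (\<lambda>x. X \<le> t * x) at_top"
      using filterlim_scale_at_top[OF \<open>t > 0\<close>] unfolding filterlim_at_top by blast
    then show "eventually (\<lambda>x. dist (ln (W (t * x)) - ln (W x)) (\<theta> * ln t) < \<epsilon>) at_top"
      using eventually_ge_at_top[of X]
    proof eventually_elim
      case (elim x)
      have "ln (t * x) - ln x = ln t"
        using elim X(1) that by (simp add: ln_mult_pos)
      then have "\<bar>ln (W (t * x)) - ln (W x) - \<theta> * ln t\<bar> \<le> \<delta> * \<bar>ln t\<bar>"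
        using X'[of x "t * x"] elim by simp
      also have "\<dots> < \<epsilon>"
        using \<open>\<epsilon> > 0\<close> by (simp add: \<delta>_def field_simps)
      finally show ?case by (simp add: dist_real_def)
    qed
  qed
  then have "((\<lambda>x. exp (ln (W (t * x)) - ln (W x))) \<longlongrightarrow> t powr \<theta>) at_top" if "t > 0" for t
    using that tendsto_exp[of _ "\<theta> * ln t"] by (auto simp: powr_def)
  moreover have "eventually (\<lambda>x. exp (ln (W (t * x)) - ln (W x)) = W (t * x) / W x) at_top" if "t > 0" for t
    using eventually_gt_at_top[of 0]
    by eventually_elim (use that W_pos in \<open>simp add: exp_diff\<close>)
  ultimately show ?thesis
    unfolding RV_iff_tendsto_ratio[OF eventually_W_neq_0] by (blast intro: Lim_transform_eventually)
qed

section \<open>Transfer of regular variation between the tail, the moments and each other\<close>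

lemma Fbar_pos:
  assumes "Fbar \<in> RV \<rho>"
  shows "0 < Fbar x"
proof -
  have "eventually (\<lambda>y. Fbar y \<noteq> 0 \<and> x \<le> y) at_top"
    using RV_eventually_nonzero[OF assms] eventually_ge_at_top[of x] by eventually_elim simp
  then obtain y where "Fbar y \<noteq> 0" "x \<le> y"
    using eventually_happens trivial_limit_at_top_linorder by blast
  then show ?thesis
    using Fbar_antimono[of x y] Fbar_nonneg[of y] by linarith
qed

text \<open>\<open>w (2 * x) / w x\<close> tends to \<open>2 powr \<theta>\<close>, which exceeds 1,
  so \<open>w\<close> does not decrease along \<open>2 ^ n * x0\<close>. Each doubling then adds at
  least a fixed amount to \<open>W\<close>.\<close>

lemma W_at_top:
  assumes Fbar: "Fbar \<in> RV (\<theta> - \<alpha>)" and "\<theta> > 0"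
  shows "filterlim W at_top at_top"
proof -
  define w where "w x = x powr \<alpha> * Fbar x" for x
  have "w \<in> RV \<theta>"
    unfolding w_def using RV_powr_mult[OF Fbar, of \<alpha>] by simp
  then have "((\<lambda>x. w (2 * x) / w x) \<longlongrightarrow> 2 powr \<theta>) at_top"
    by (rule RV_ratio) simp
  then have "eventually (\<lambda>x. 1 < w (2 * x) / w x) at_top"
    using \<open>\<theta> > 0\<close> by (intro order_tendstoD) auto
  then obtain X where X: "\<And>x. x \<ge> X \<Longrightarrow> 1 < w (2 * x) / w x"
    unfolding eventually_at_top_linorder by blast
  define x0 where "x0 = max X 1"
  have x0: "x0 > 0" "X \<le> x0" by (simp_all add: x0_def)
  have w_pos: "0 < w x" if "x > 0" for x
    using that Fbar_pos[OF Fbar] by (simp add: w_def)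
  \<comment> \<open>By the lower increment bound, \<open>W\<close> gains at least
    \<open>(1 - 2 powr - \<alpha>) * w (2 * x) / \<alpha>\<close> from \<open>x\<close> to
    \<open>2 * x\<close>; \<open>c\<close> is this gain with \<open>w\<close> replaced by its lower
    bound \<open>w x0\<close>.\<close>
  define c where "c = (1 - 2 powr - \<alpha>) * w x0 / \<alpha>"
  have "2 powr - \<alpha> < (1 :: real)" using \<alpha>_pos by (simp add: powr_less_one)
  then have "c > 0" using w_pos[OF x0(1)] \<alpha>_pos by (simp add: c_def)
  have large: "x0 \<le> 2 ^ n * x0" for n :: nat
    using x0 by (simp add: mult_le_cancel_right1)
  have w_ge: "w x0 \<le> w (2 ^ n * x0)" for n :: nat
  proof (induction n)
    case (Suc n)
    have "0 < 2 ^ n * x0" "X \<le> 2 ^ n * x0" using large[of n] x0 by linarith+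
    then have "w (2 ^ n * x0) \<le> w (2 * (2 ^ n * x0))"
      using X[of "2 ^ n * x0"] w_pos[of "2 ^ n * x0"] by (simp add: less_divide_eq)
    with Suc show ?case by (simp add: mult.assoc)
  qed simp
  have W_ge: "real n * c \<le> W (2 ^ n * x0)" for n :: nat
  proof (induction n)
    case 0
    then show ?case using W_pos[OF x0(1)] by simp
  next
    case (Suc n)
    let ?x = "2 ^ n * x0"
    have pos: "0 < ?x" using x0 by simp
    have "(1 - 2 powr - \<alpha>) * w x0 \<le> (1 - 2 powr - \<alpha>) * w (2 ^ Suc n * x0)"
      using \<open>2 powr - \<alpha> < 1\<close> by (intro mult_left_mono w_ge) simp
    also have "\<dots> = Fbar (2 * ?x) * ((2 * ?x) powr \<alpha> - ?x powr \<alpha>)"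
      using pos x0 by (simp add: w_def powr_mult powr_minus field_simps)
    also have "\<dots> \<le> \<alpha> * (W (2 * ?x) - W ?x)"
      using x0 by (intro W_increment) auto
    finally have "c \<le> W (2 * ?x) - W ?x"
      using \<alpha>_pos by (simp add: c_def pos_divide_le_eq mult.commute)
    with Suc show ?case by (simp add: algebra_simps)
  qed
  show ?thesis
    unfolding filterlim_at_top
  proof
    fix Z
    obtain n :: nat where "Z / c < real n" using reals_Archimedean2 by blast
    then have "Z \<le> W (2 ^ n * x0)"
      using W_ge[of n] \<open>c > 0\<close> by (simp add: pos_divide_less_eq)
    show "eventually (\<lambda>x. Z \<le> W x) at_top"
      using eventually_ge_at_top[of "2 ^ n * x0"]
    proof eventually_elim
      case (elim x)
      then show ?case
        using \<open>Z \<le> W (2 ^ n * x0)\<close> W_mono[OF _ elim] x0 by simp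
    qed
  qed
qed

text \<open>The quotient of the derivatives of \<open>W (t * x)\<close> and \<open>W x\<close> is
  \<open>t powr \<alpha> * (Fbar (t * x) / Fbar x)\<close>, whose limit is
  \<open>t powr \<theta>\<close>.\<close>

lemma W_RV_if_Fbar_RV:
  assumes Fbar: "Fbar \<in> RV (\<theta> - \<alpha>)" and "\<theta> > 0"
  shows "W \<in> RV \<theta>"
  unfolding RV_iff_tendsto_ratio[OF eventually_W_neq_0]
proof (intro allI impI)
  fix t :: real assume "t > 0"
  show "((\<lambda>x. W (t * x) / W x) \<longlongrightarrow> t powr \<theta>) at_top"
  proof (rule lhopital_right_at_top)
    show "isCont (\<lambda>x. W (t * x)) x" "isCont W x" if "x > 0" for x
      using that \<open>t > 0\<close> by (auto intro!: isCont_scale isCont_W)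
    show "((\<lambda>x. W (t * x)) has_real_derivative (t * x) powr (\<alpha> - 1) * Fbar (t * x) * t) (at_right x)"
      if "x > 0" for x
      using that \<open>t > 0\<close> by (intro right_derivative_scale W_right_derivative) auto
    show "(W has_real_derivative x powr (\<alpha> - 1) * Fbar x) (at_right x)" if "x > 0" for x
      using that by (rule W_right_derivative)
    show "eventually (\<lambda>x. 0 < x powr (\<alpha> - 1) * Fbar x) at_top"
      using eventually_gt_at_top[of 0] by eventually_elim (simp add: Fbar_pos[OF Fbar])
    have "((\<lambda>x. t powr \<alpha> * (Fbar (t * x) / Fbar x)) \<longlongrightarrow> t powr \<alpha> * t powr (\<theta> - \<alpha>)) at_top"
      by (intro tendsto_intros RV_ratio Fbar \<open>t > 0\<close>)
    moreover have "eventually (\<lambda>x. t powr \<alpha> * (Fbar (t * x) / Fbar x)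
        = (t * x) powr (\<alpha> - 1) * Fbar (t * x) * t / (x powr (\<alpha> - 1) * Fbar x)) at_top"
      using eventually_gt_at_top[of 0]
      by eventually_elim (use \<open>t > 0\<close> in \<open>simp add: powr_mult powr_diff\<close>)
    ultimately show "((\<lambda>x. (t * x) powr (\<alpha> - 1) * Fbar (t * x) * t / (x powr (\<alpha> - 1) * Fbar x))
        \<longlongrightarrow> t powr \<theta>) at_top"
      unfolding powr_add[symmetric] by (auto intro: Lim_transform_eventually)
    show "filterlim W at_top at_top" by (rule W_at_top[OF assms])
  qed
qed

text \<open>Since \<open>r\<close> tends to \<theta>, which is nonzero,
  \<open>x powr \<alpha> * Fbar x\<close> is asymptotic to \<open>\<theta> * W x\<close> and
  inherits its index.\<close>

lemma Fbar_RV_if_W_RV: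
  assumes W: "W \<in> RV \<theta>" and "\<theta> > 0"
  shows "Fbar \<in> RV (\<theta> - \<alpha>)"
proof -
  have "(\<lambda>x. x powr \<alpha> * Fbar x) \<in> RV \<theta>"
    using RV_asymp[OF W, of "\<lambda>x. x powr \<alpha> * Fbar x" \<theta>] r_tendsto_if_W_RV[OF W] \<open>\<theta> > 0\<close>
    by (simp add: r_def[abs_def])
  then have *: "(\<lambda>x. x powr - \<alpha> * (x powr \<alpha> * Fbar x)) \<in> RV (\<theta> - \<alpha>)"
    using RV_powr_mult[of _ \<theta> "- \<alpha>"] by simp
  have "eventually (\<lambda>x. x powr - \<alpha> * (x powr \<alpha> * Fbar x) = Fbar x) at_top"
    using eventually_gt_at_top[of 0] by eventually_elim (simp add: powr_minus)
  from RV_cong[OF this *] show ?thesis .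
qed

text \<open>By l'Hopital's rule, \<open>W x / x powr \<alpha>\<close> has the same limit as
  \<open>Fbar x / \<alpha>\<close>. The result supplies the vanishing limits for the 0/0 rule
  applied to \<open>k\<close>.\<close>

lemma powr_W_tendsto_0: "((\<lambda>x. x powr - \<alpha> * W x) \<longlongrightarrow> 0) at_top"
proof (rule lhopital_right_at_top[where f = W and g = "\<lambda>x. x powr \<alpha>", THEN Lim_transform_eventually])
  show "((\<lambda>x. x powr \<alpha>) has_real_derivative \<alpha> * x powr (\<alpha> - 1)) (at_right x)" if "x > 0" for x
    using that by (rule has_field_derivative_at_within[OF has_real_derivative_powr])
  show "isCont (\<lambda>x. x powr \<alpha>) x" if "x > 0" for x
    using that by (intro continuous_intros) auto
  show "eventually (\<lambda>x. 0 < \<alpha> * x powr (\<alpha> - 1)) at_top"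
    using eventually_gt_at_top[of 0] by eventually_elim (simp add: \<alpha>_pos)
  have "((\<lambda>x. Fbar x / \<alpha>) \<longlongrightarrow> 0 / \<alpha>) at_top"
    using \<alpha>_pos by (intro tendsto_intros Fbar_tendsto_0) simp
  moreover have "eventually (\<lambda>x. Fbar x / \<alpha> = x powr (\<alpha> - 1) * Fbar x / (\<alpha> * x powr (\<alpha> - 1))) at_top"
    using eventually_gt_at_top[of 0] by eventually_elim simp
  ultimately show "((\<lambda>x. x powr (\<alpha> - 1) * Fbar x / (\<alpha> * x powr (\<alpha> - 1))) \<longlongrightarrow> 0) at_top"
    by (auto intro: Lim_transform_eventually)
  show "filterlim (\<lambda>x. x powr \<alpha>) at_top at_top"
    by (rule real_powr_at_top[OF \<alpha>_pos])
  show "eventually (\<lambda>x. W x / x powr \<alpha> = x powr - \<alpha> * W x) at_top"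
    by (simp add: powr_minus field_simps)
qed (auto intro: isCont_W W_right_derivative)

text \<open>\<open>H\<close> governs the derivative of \<open>k\<close>, which tends to 0 in every
  case, so the 0/0 form of l'Hopital's rule also covers \<theta> = 0, where \<open>W\<close> may
  stay bounded.\<close>

lemma W_RV_if_H_RV:
  assumes H: "H \<in> RV \<theta>"
  shows "W \<in> RV \<theta>"
proof -
  define k where "k x = x powr - \<alpha> * W x" for x
  \<comment> \<open>The sign is reversed because the rule asks for a denominator with positive
    derivative, and \<open>k\<close> is decreasing.\<close>
  have cont: "isCont (\<lambda>x. - k x) x" if "x > 0" for x
    unfolding k_def using that by (intro continuous_intros isCont_W) auto
  have der: "((\<lambda>x. - k x) has_real_derivative x powr (- \<alpha> - 1) * H x) (at_right x)" if "x > 0" for x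
  proof -
    have "((\<lambda>x. x powr - \<alpha>) has_real_derivative - \<alpha> * x powr (- \<alpha> - 1)) (at_right x)"
      using that by (rule has_field_derivative_at_within[OF has_real_derivative_powr])
    \<comment> \<open>The product rule yields \<open>x powr (- \<alpha> - 1)\<close> times
      \<open>\<alpha> * W x - x powr \<alpha> * Fbar x\<close>, and the second factor is
      \<open>H x\<close>.\<close>
    from DERIV_minus[OF DERIV_mult'[OF this W_right_derivative[OF that]]]
    show ?thesis
      unfolding k_def
      by (rule DERIV_cong) (use that in \<open>simp add: H_eq powr_diff powr_minus field_simps\<close>)
  qed
  have k_0: "((\<lambda>x. - k x) \<longlongrightarrow> 0) at_top"
    using tendsto_minus[OF powr_W_tendsto_0] by (simp add: k_def)
  have k_neq: "eventually (\<lambda>x. - k x \<noteq> 0) at_top"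
    using eventually_W_neq_0 eventually_gt_at_top[of 0] by eventually_elim (simp add: k_def)
  have "((\<lambda>x. - k (t * x) / - k x) \<longlongrightarrow> t powr (\<theta> - \<alpha>)) at_top" if "t > 0" for t
  proof (rule lhopital_right_at_top_0)
    show "isCont (\<lambda>x. - k (t * x)) x" if "x > 0" for x
      using that \<open>t > 0\<close> by (intro isCont_scale[where f = "\<lambda>x. - k x"] cont) simp
    show "((\<lambda>x. - k (t * x)) has_real_derivative (t * x) powr (- \<alpha> - 1) * H (t * x) * t) (at_right x)"
      if "x > 0" for x
      using that \<open>t > 0\<close> by (intro right_derivative_scale der) auto
    show "eventually (\<lambda>x. 0 < x powr (- \<alpha> - 1) * H x) at_top"
      using H_pos eventually_gt_at_top[of 0] by eventually_elim simp
    have "((\<lambda>x. t powr - \<alpha> * (H (t * x) / H x)) \<longlongrightarrow> t powr - \<alpha> * t powr \<theta>) at_top"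
      by (intro tendsto_intros RV_ratio H \<open>t > 0\<close>)
    moreover have "eventually (\<lambda>x. t powr - \<alpha> * (H (t * x) / H x)
        = (t * x) powr (- \<alpha> - 1) * H (t * x) * t / (x powr (- \<alpha> - 1) * H x)) at_top"
      using eventually_gt_at_top[of 0]
      by eventually_elim (use \<open>t > 0\<close> in \<open>simp add: powr_mult powr_diff\<close>)
    ultimately show "((\<lambda>x. (t * x) powr (- \<alpha> - 1) * H (t * x) * t / (x powr (- \<alpha> - 1) * H x))
        \<longlongrightarrow> t powr (\<theta> - \<alpha>)) at_top"
      unfolding powr_add[symmetric] by (auto intro: Lim_transform_eventually)
    show "((\<lambda>x. - k (t * x)) \<longlongrightarrow> 0) at_top"
      by (rule filterlim_compose[OF k_0 filterlim_scale_at_top[OF \<open>t > 0\<close>]])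
  qed (use cont der k_0 k_neq in auto)
  then have "k \<in> RV (\<theta> - \<alpha>)"
    using k_neq by (subst RV_iff_tendsto_ratio) auto
  then have *: "(\<lambda>x. x powr \<alpha> * k x) \<in> RV \<theta>"
    using RV_powr_mult[of k "\<theta> - \<alpha>" \<alpha>] by simp
  have "eventually (\<lambda>x. x powr \<alpha> * k x = W x) at_top"
    using eventually_gt_at_top[of 0] by eventually_elim (simp add: k_def powr_minus)
  from RV_cong[OF this *] show ?thesis .
qed

section \<open>The ratio criteria in terms of \<open>r\<close>\<close>

lemma H_eq_W_r:
  assumes "0 < x"
  shows "H x = W x * (\<alpha> - r x)"
  using W_pos[OF assms] assms by (simp add: H_eq r_def field_simps)

text \<open>\<open>H x / W x = \<alpha> - r x\<close> tends to \<open>\<alpha> - \<theta>\<close>,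
  which is nonzero.\<close>

lemma H_RV_if_W_RV:
  assumes W: "W \<in> RV \<theta>" and "\<theta> < \<alpha>"
  shows "H \<in> RV \<theta>"
proof (rule RV_asymp[OF W])
  have "((\<lambda>x. \<alpha> - r x) \<longlongrightarrow> \<alpha> - \<theta>) at_top"
    by (intro tendsto_intros r_tendsto_if_W_RV W)
  moreover have "eventually (\<lambda>x. \<alpha> - r x = H x / W x) at_top"
    using eventually_gt_at_top[of 0] eventually_W_neq_0 by eventually_elim (simp add: H_eq_W_r)
  ultimately show "((\<lambda>x. H x / W x) \<longlongrightarrow> \<alpha> - \<theta>) at_top"
    by (rule Lim_transform_eventually)
qed (use \<open>\<theta> < \<alpha>\<close> in simp)

lemma Fbar_Gbar_iff:
  "((\<lambda>x. Fbar x / Gbar x) \<longlongrightarrow> \<theta> / \<alpha>) at_top \<longleftrightarrow> (r \<longlongrightarrow> \<theta>) at_top"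
proof -
  have ev: "eventually (\<lambda>x. Fbar x / Gbar x = r x / \<alpha>) at_top"
    using eventually_gt_at_top[of 0] by eventually_elim (simp add: r_def Gbar_eq powr_minus field_simps)
  have "((\<lambda>x. r x / \<alpha>) \<longlongrightarrow> \<theta> / \<alpha>) at_top \<longleftrightarrow> (r \<longlongrightarrow> \<theta>) at_top"
    using \<alpha>_pos tendsto_mult_right_iff[of "1 / \<alpha>" r \<theta> at_top] by simp
  then show ?thesis by (simp add: tendsto_cong[OF ev])
qed

text \<open>Positivity of \<open>H = W * (\<alpha> - r)\<close> keeps \<open>r\<close> below
  \<alpha>, so that dividing by \<open>\<alpha> - r\<close> is legitimate.\<close>

lemma eventually_r_less: "eventually (\<lambda>x. 0 < x \<and> 0 < \<alpha> - r x) at_top"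
  using H_pos eventually_gt_at_top[of 0]
proof eventually_elim
  case (elim x)
  then have "0 < W x * (\<alpha> - r x)" by (simp only: H_eq_W_r)
  then show ?case using W_pos[of x] elim by (simp add: zero_less_mult_iff)
qed

text \<open>The ratio is eventually \<open>\<alpha> / (\<alpha> - r x)\<close>, a function of
  \<open>r\<close> that is continuous and can be inverted near the limit.\<close>

lemma Gbar_H_iff:
  assumes "\<theta> < \<alpha>"
  shows "((\<lambda>x. x powr \<alpha> * Gbar x / H x) \<longlongrightarrow> \<alpha> / (\<alpha> - \<theta>)) at_top \<longleftrightarrow> (r \<longlongrightarrow> \<theta>) at_top"
proof -
  have ev: "eventually (\<lambda>x. x powr \<alpha> * Gbar x / H x = \<alpha> / (\<alpha> - r x)) at_top"
    using eventually_r_less eventually_W_neq_0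
    by eventually_elim (simp add: H_eq_W_r Gbar_eq powr_minus field_simps)
  show ?thesis
  proof
    assume "(r \<longlongrightarrow> \<theta>) at_top"
    then have "((\<lambda>x. \<alpha> / (\<alpha> - r x)) \<longlongrightarrow> \<alpha> / (\<alpha> - \<theta>)) at_top"
      using assms by (intro tendsto_intros) auto
    then show "((\<lambda>x. x powr \<alpha> * Gbar x / H x) \<longlongrightarrow> \<alpha> / (\<alpha> - \<theta>)) at_top"
      by (simp add: tendsto_cong[OF ev])
  next
    assume "((\<lambda>x. x powr \<alpha> * Gbar x / H x) \<longlongrightarrow> \<alpha> / (\<alpha> - \<theta>)) at_top"
    then have lim: "((\<lambda>x. \<alpha> / (\<alpha> - r x)) \<longlongrightarrow> \<alpha> / (\<alpha> - \<theta>)) at_top"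
      by (simp add: tendsto_cong[OF ev])
    \<comment> \<open>The map \<open>y\<close> to \<open>\<alpha> - \<alpha> / y\<close> inverts the
      expression; it is continuous at the limit, which is nonzero.\<close>
    have "((\<lambda>x. \<alpha> - \<alpha> / (\<alpha> / (\<alpha> - r x))) \<longlongrightarrow> \<alpha> - \<alpha> / (\<alpha> / (\<alpha> - \<theta>))) at_top"
      using assms \<alpha>_pos by (intro tendsto_diff[OF tendsto_const tendsto_divide[OF tendsto_const lim]]) simp
    moreover have "eventually (\<lambda>x. \<alpha> - \<alpha> / (\<alpha> / (\<alpha> - r x)) = r x) at_top"
      using eventually_r_less by eventually_elim (use \<alpha>_pos in simp)
    ultimately show "(r \<longlongrightarrow> \<theta>) at_top"
      using assms \<alpha>_pos by (auto intro: Lim_transform_eventually)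
  qed
qed

text \<open>Because \<open>x powr \<alpha> * Gbar x = H x + x powr \<alpha> * Fbar x\<close>, the
  two ratios differ by exactly 1, and so do the two limits.\<close>

lemma Fbar_H_iff:
  assumes "\<theta> < \<alpha>"
  shows "((\<lambda>x. x powr \<alpha> * Fbar x / H x) \<longlongrightarrow> \<theta> / (\<alpha> - \<theta>)) at_top
    \<longleftrightarrow> ((\<lambda>x. x powr \<alpha> * Gbar x / H x) \<longlongrightarrow> \<alpha> / (\<alpha> - \<theta>)) at_top"
proof -
  have ev: "eventually (\<lambda>x. x powr \<alpha> * Gbar x / H x = 1 + x powr \<alpha> * Fbar x / H x) at_top"
    using H_pos eventually_gt_at_top[of 0]
    by eventually_elim (simp add: Gbar_eq H_eq powr_minus field_simps)
  have "\<alpha> / (\<alpha> - \<theta>) = 1 + \<theta> / (\<alpha> - \<theta>)"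
    using assms by (simp add: field_simps)
  then show ?thesis
    by (simp add: tendsto_cong[OF ev] tendsto_add_const_iff)
qed

end

theorem theorem4:
  fixes F :: "real \<Rightarrow> real" and \<alpha> \<theta> :: real
  assumes "nonneg_distribution_function F" and "F 0 = 0"
    and "\<alpha> > 0" and "0 \<le> \<theta>" and "\<theta> \<le> \<alpha>"
  shows
    "let H = truncated_moment F \<alpha>;
         W = tail_moment F \<alpha>;
         Fbar = tail F;
         Gbar = tail (williamson F \<alpha>);
         a = (Fbar \<in> RV (\<theta> - \<alpha>));
         b = (Gbar \<in> RV (\<theta> - \<alpha>));
         c = (W \<in> RV \<theta>);
         d = ((\<lambda>x. Fbar x / Gbar x) \<longlongrightarrow> \<theta> / \<alpha>) at_top;
         e = (H \<in> RV \<theta>);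
         f = ((\<lambda>x. x powr \<alpha> * Fbar x / H x) \<longlongrightarrow> \<theta> / (\<alpha> - \<theta>)) at_top;
         g = ((\<lambda>x. x powr \<alpha> * Gbar x / H x) \<longlongrightarrow> \<alpha> / (\<alpha> - \<theta>)) at_top;
         h = ((\<lambda>x. x powr \<alpha> * Fbar x / W x) \<longlongrightarrow> \<theta>) at_top
     in (0 < \<theta> \<and> \<theta> < \<alpha> \<longrightarrow>
           (a \<longleftrightarrow> b) \<and> (b \<longleftrightarrow> c) \<and> (c \<longleftrightarrow> d) \<and> (d \<longleftrightarrow> e) \<and> (e \<longleftrightarrow> f) \<and> (f \<longleftrightarrow> g) \<and> (g \<longleftrightarrow> h)) \<and>
        (\<theta> = 0 \<longrightarrow>
           (b \<longleftrightarrow> c) \<and> (c \<longleftrightarrow> d) \<and> (d \<longleftrightarrow> e) \<and> (e \<longleftrightarrow> f) \<and> (f \<longleftrightarrow> g) \<and> (g \<longleftrightarrow> h)) \<and>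
        (\<theta> = \<alpha> \<longrightarrow>
           (a \<longleftrightarrow> b) \<and> (b \<longleftrightarrow> c) \<and> (b \<longrightarrow> d))"
proof -
  interpret tail_on_nonneg F \<alpha>
    by unfold_locales (use assms in auto)
  have h: "((\<lambda>x. x powr \<alpha> * Fbar x / W x) \<longlongrightarrow> \<theta>) at_top \<longleftrightarrow> (r \<longlongrightarrow> \<theta>) at_top"
    by (simp add: r_def[abs_def])
  have c: "W \<in> RV \<theta> \<longleftrightarrow> (r \<longlongrightarrow> \<theta>) at_top"
    using r_tendsto_if_W_RV W_RV_if_r_tendsto by blast
  \<comment> \<open>The restrictions on \<theta> mirror the three cases: (a) is tied to
    \<open>r\<close> for \<theta> > 0, and (e), (f), (g) are tied to it for \<theta> <
    \<alpha>.\<close>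
  have a: "Fbar \<in> RV (\<theta> - \<alpha>) \<longleftrightarrow> (r \<longlongrightarrow> \<theta>) at_top" if "\<theta> > 0"
    using W_RV_if_Fbar_RV[OF _ that] Fbar_RV_if_W_RV[OF _ that] c by blast
  have e: "H \<in> RV \<theta> \<longleftrightarrow> (r \<longlongrightarrow> \<theta>) at_top" if "\<theta> < \<alpha>"
    using W_RV_if_H_RV H_RV_if_W_RV[OF _ that] c by blast
  have g: "((\<lambda>x. x powr \<alpha> * Gbar x / H x) \<longlongrightarrow> \<alpha> / (\<alpha> - \<theta>)) at_top \<longleftrightarrow> (r \<longlongrightarrow> \<theta>) at_top"
    if "\<theta> < \<alpha>"
    using that by (rule Gbar_H_iff)
  have f: "((\<lambda>x. x powr \<alpha> * Fbar x / H x) \<longlongrightarrow> \<theta> / (\<alpha> - \<theta>)) at_top \<longleftrightarrow> (r \<longlongrightarrow> \<theta>) at_top"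
    if "\<theta> < \<alpha>"
    using Fbar_H_iff[OF that] g[OF that] by blast
  have "\<theta> = 0 \<Longrightarrow> \<theta> < \<alpha>" "\<theta> = \<alpha> \<Longrightarrow> \<theta> > 0"
    using assms(3) by simp_all
  then show ?thesis
    unfolding Let_def Gbar_RV_iff c h Fbar_Gbar_iff using a e f g by blast
qed

end
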